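(* Let $\mathscr{F}\subseteq\mathscr{P}(\omega)$ be a nonempty $\omega$-closed family. Then the following conditions are equivalent: (i) $\boldsymbol{B}_{\omega}^{\mathscr{F}}$ is a bisimple semigroup; (ii) $\mathscr{F}$ is a one-element family; (iii) the semigroup $\boldsymbol{B}_{\omega}^{\mathscr{F}}$ is either trivial (one-element) or isomorphic to the bicyclic monoid.
   Context: $\omega$ is the set of non-negative integers, $\mathscr{P}(\omega)$ its power set. For an integer $n$ and $F\subseteq\omega$ put $n+F=\{n+k\colon k\in F\}\subseteq\mathbb{Z}$ (empty if $F=\varnothing$). A family $\mathscr{F}\subseteq\mathscr{P}(\omega)$ is $\omega$-closed if $F_1\cap(-n+F_2)\in\mathscr{F}$ for all $n\in\omega$ and $F_1,F_2\in\mathscr{F}$. For an $\omega$-closed family $\mathscr{F}$, the set $\boldsymbol{B}_{\omega}\times\mathscr{F}=\omega\times\omega\times\mathscr{F}$ carries the semigroup operation $$(i_1,j_1,F_1)\cdot(i_2,j_2,F_2)=\begin{cases}(i_1-j_1+i_2,\,j_2,\,(j_1-i_2+F_1)\cap F_2), & j_1\leqslant i_2;\\ (i_1,\,j_1-i_2+j_2,\,F_1\cap(i_2-j_1+F_2)), & j_1\geqslant i_2.\end{cases}$$ If $\varnothing\notin\mathscr{F}$, then $\boldsymbol{B}_{\omega}^{\mathscr{F}}=(\boldsymbol{B}_{\omega}\times\mathscr{F},\cdot)$. If $\varnothing\in\mathscr{F}$, then $\boldsymbol{I}=\{(i,j,\varnothing)\colon i,j\in\omega\}$ is an ideal and $\boldsymbol{B}_{\omega}^{\mathscr{F}}$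 is the Rees quotient $(\boldsymbol{B}_{\omega}\times\mathscr{F},\cdot)/\boldsymbol{I}$, in which all $(i,j,\varnothing)$ are identified to a single zero element $\boldsymbol{0}$. A semigroup is bisimple if it consists of a single $\mathscr{D}$-class (Green's relation $\mathscr{D}$). The bicyclic monoid is the monoid generated by $\{p,q\}$ subject to the single relation $pq=1$; equivalently, $\omega\times\omega$ with $(i_1,j_1)\cdot(i_2,j_2)=(i_1+i_2-\min\{j_1,i_2\},\,j_1+j_2-\min\{j_1,i_2\})$. *)

theory Defs
  imports Main
begin

section \<open>Semigroups with an explicit carrier\<close>

record 'a sgrp =
  carr :: "'a set"
  mul :: "'a \<Rightarrow> 'a \<Rightarrow> 'a"

definition is_semigroup :: "'a sgrp \<Rightarrow> bool" where
  "is_semigroup S \<longleftrightarrow>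
     (\<forall>x\<in>carr S. \<forall>y\<in>carr S. mul S x y \<in> carr S) \<and>
     (\<forall>x\<in>carr S. \<forall>y\<in>carr S. \<forall>z\<in>carr S. mul S (mul S x y) z = mul S x (mul S y z))"

definition sgrp_isomorphic :: "'a sgrp \<Rightarrow> 'b sgrp \<Rightarrow> bool" where
  "sgrp_isomorphic S T \<longleftrightarrow>
     (\<exists>h. bij_betw h (carr S) (carr T) \<and>
          (\<forall>x\<in>carr S. \<forall>y\<in>carr S. h (mul S x y) = mul T (h x) (h y)))"

definition trivial_sgrp :: "'a sgrp \<Rightarrow> bool" where
  "trivial_sgrp S \<longleftrightarrow> (\<exists>e. carr S = {e})"

definition quotient_sgrp :: "'a sgrp \<Rightarrow> ('a \<times> 'a) set \<Rightarrow> 'a set sgrp" where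
  "quotient_sgrp S r =
     \<lparr> carr = carr S // r,
       mul = (\<lambda>X Y. \<Union>x\<in>X. \<Union>y\<in>Y. r `` {mul S x y}) \<rparr>"

definition is_congruence :: "'a sgrp \<Rightarrow> ('a \<times> 'a) set \<Rightarrow> bool" where
  "is_congruence S r \<longleftrightarrow> equiv (carr S) r \<and>
     (\<forall>(x, x') \<in> r. \<forall>(y, y') \<in> r. (mul S x y, mul S x' y') \<in> r)"

definition is_ideal :: "'a sgrp \<Rightarrow> 'a set \<Rightarrow> bool" where
  "is_ideal S I \<longleftrightarrow> I \<subseteq> carr S \<and> (\<forall>x\<in>carr S. \<forall>a\<in>I. mul S x a \<in> I \<and> mul S a x \<in> I)"

definition rees_quotient :: "'a sgrp \<Rightarrow> 'a set \<Rightarrow> 'a set sgrp" where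
  "rees_quotient S I = quotient_sgrp S (I \<times> I \<union> Id_on (carr S))"


section \<open>Green's relations\<close>

text \<open>The principal one-sided ideals \<open>a S\<^sup>1\<close> and \<open>S\<^sup>1 a\<close>.\<close>

definition right_principal :: "'a sgrp \<Rightarrow> 'a \<Rightarrow> 'a set" where
  "right_principal S a = insert a {mul S a s | s. s \<in> carr S}"

definition left_principal :: "'a sgrp \<Rightarrow> 'a \<Rightarrow> 'a set" where
  "left_principal S a = insert a {mul S s a | s. s \<in> carr S}"

definition green_R :: "'a sgrp \<Rightarrow> ('a \<times> 'a) set" where
  "green_R S = {(a, b). a \<in> carr S \<and> b \<in> carr S \<and> right_principal S a = right_principal S b}"

definition green_L :: "'a sgrp \<Rightarrow> ('a \<times> 'a) set" where
  "green_L S = {(a, b). a \<in> carr S \<and> b \<in> carr S \<and> left_principal S a = left_principal S b}"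

definition green_D :: "'a sgrp \<Rightarrow> ('a \<times> 'a) set" where
  "green_D S = green_L S O green_R S"

definition bisimple :: "'a sgrp \<Rightarrow> bool" where
  "bisimple S \<longleftrightarrow> is_semigroup S \<and> (\<exists>C. carr S // green_D S = {C})"


section \<open>The bicyclic monoid\<close>

datatype bicyclic_gen = gen_p | gen_q

inductive bicyclic_eq :: "bicyclic_gen list \<Rightarrow> bicyclic_gen list \<Rightarrow> bool" where
  bicyclic_eq_relator: "bicyclic_eq [gen_p, gen_q] []"
| bicyclic_eq_refl: "bicyclic_eq u u"
| bicyclic_eq_sym: "bicyclic_eq u v \<Longrightarrow> bicyclic_eq v u"
| bicyclic_eq_trans: "bicyclic_eq u v \<Longrightarrow> bicyclic_eq v w \<Longrightarrow> bicyclic_eq u w"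
| bicyclic_eq_mult: "bicyclic_eq u v \<Longrightarrow> bicyclic_eq u' v' \<Longrightarrow> bicyclic_eq (u @ u') (v @ v')"

definition bicyclic_monoid :: "bicyclic_gen list set sgrp" where
  "bicyclic_monoid =
     quotient_sgrp \<lparr> carr = UNIV, mul = (@) \<rparr> {(u, v). bicyclic_eq u v}"

definition bicyclic_pairs :: "(nat \<times> nat) sgrp" where
  "bicyclic_pairs =
     \<lparr> carr = UNIV,
       mul = (\<lambda>(i1, j1) (i2, j2). (i1 + i2 - min j1 i2, j1 + j2 - min j1 i2)) \<rparr>"


section \<open>The semigroup of an \<open>\<omega>\<close>-closed family\<close>

text \<open>\<open>shift n F\<close> is \<open>(n + F) \<inter> \<omega>\<close>. Below, \<open>n + F\<close> only occurs intersected with a subset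
  of \<open>\<omega>\<close>, so nothing is lost.\<close>

definition shift :: "int \<Rightarrow> nat set \<Rightarrow> nat set" where
  "shift n F = int -` ((\<lambda>k. n + int k) ` F)"

definition omega_closed :: "nat set set \<Rightarrow> bool" where
  "omega_closed \<F> \<longleftrightarrow> (\<forall>n::nat. \<forall>F1\<in>\<F>. \<forall>F2\<in>\<F>. F1 \<inter> shift (- int n) F2 \<in> \<F>)"

fun B_mul :: "nat \<times> nat \<times> nat set \<Rightarrow> nat \<times> nat \<times> nat set \<Rightarrow> nat \<times> nat \<times> nat set" where
  "B_mul (i1, j1, F1) (i2, j2, F2) =
     (if j1 \<le> i2 then (i1 + (i2 - j1), j2, shift (int j1 - int i2) F1 \<inter> F2)
      else (i1, (j1 - i2) + j2, F1 \<inter> shift (int i2 - int j1) F2))"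

definition B_prod :: "nat set set \<Rightarrow> (nat \<times> nat \<times> nat set) sgrp" where
  "B_prod \<F> = \<lparr> carr = UNIV \<times> UNIV \<times> \<F>, mul = B_mul \<rparr>"

definition B_null :: "nat set set \<Rightarrow> (nat \<times> nat \<times> nat set) set" where
  "B_null \<F> = {(i, j, F). F \<in> \<F> \<and> F = {}}"

text \<open>If \<open>{} \<notin> \<F>\<close> then \<open>B_null \<F>\<close> is empty and the quotient is by equality: its elements are the
  singletons of elements of \<open>B_prod \<F>\<close> (see \<open>B_sgrp_without_empty\<close> below).\<close>

definition B_sgrp :: "nat set set \<Rightarrow> (nat \<times> nat \<times> nat set) set sgrp" where
  "B_sgrp \<F> = rees_quotient (B_prod \<F>) (B_null \<F>)"


section \<open>Consistency of the definitions\<close>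

lemma mem_shift_neg: "k \<in> shift (- int n) F \<longleftrightarrow> k + n \<in> F"
proof
  assume "k \<in> shift (- int n) F"
  then obtain m where "m \<in> F" "int k = - int n + int m" by (auto simp: shift_def)
  moreover from this have "m = k + n" by linarith
  ultimately show "k + n \<in> F" by simp
next
  assume "k + n \<in> F"
  moreover have "int k = - int n + int (k + n)" by simp
  ultimately show "k \<in> shift (- int n) F" unfolding shift_def by blast
qed

lemma mem_shift_diff: "a \<le> b \<Longrightarrow> k \<in> shift (int a - int b) F \<longleftrightarrow> k + (b - a) \<in> F"
  using mem_shift_neg[of k "b - a" F] by (simp add: of_nat_diff)

lemma B_mul_ge:
  "j1 \<ge> i2 \<Longrightarrow> B_mul (i1, j1, F1) (i2, j2, F2)
     = (i1, j1 - i2 + j2, F1 \<inter> shift (int i2 - int j1) F2)"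
  using mem_shift_neg[of _ 0] by auto

lemma B_mul_closed:
  assumes "omega_closed \<F>" "x \<in> carr (B_prod \<F>)" "y \<in> carr (B_prod \<F>)"
  shows "B_mul x y \<in> carr (B_prod \<F>)"
proof -
  obtain i1 j1 F1 i2 j2 F2 where xy: "x = (i1, j1, F1)" "y = (i2, j2, F2)"
    by (metis prod_cases3)
  have F: "F1 \<in> \<F>" "F2 \<in> \<F>" using assms(2,3) xy by (auto simp: B_prod_def)
  have *: "G \<inter> shift (int a - int b) H \<in> \<F>" if "a \<le> b" "G \<in> \<F>" "H \<in> \<F>" for a b G H
  proof -
    have "int a - int b = - int (b - a)" using that by simp
    then show ?thesis using assms(1) that by (simp only: omega_closed_def)
  qed
  show ?thesis
    using *[of j1 i2 F2 F1] *[of i2 j1 F1 F2] F by (auto simp: xy B_prod_def Int_commute)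
qed

lemma B_mul_nat:
  "B_mul (i1, j1, F1) (i2, j2, F2) =
     (if j1 \<le> i2 then (i1 + (i2 - j1), j2, {k \<in> F2. k + (i2 - j1) \<in> F1})
      else (i1, (j1 - i2) + j2, {k \<in> F1. k + (j1 - i2) \<in> F2}))"
  by (auto simp: mem_shift_diff)

lemma B_mul_assoc: "B_mul (B_mul x y) z = B_mul x (B_mul y z)"
proof -
  obtain i1 j1 F1 i2 j2 F2 i3 j3 F3
    where xyz: "x = (i1, j1, F1)" "y = (i2, j2, F2)" "z = (i3, j3, F3)"
    by (metis prod_cases3)
  have le: "a \<le> b \<and> (\<exists>d. b = a + d) \<or> \<not> a \<le> b \<and> (\<exists>d. a = b + Suc d)" for a b :: nat
    by (metis le_Suc_ex not_less_eq_eq add_Suc_shift)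
  show ?thesis
    using le[of j1 i2] le[of j2 i3]
    by (auto simp: xyz B_mul_nat algebra_simps simp del: B_mul.simps)
qed

lemma semigroup_B_prod: "omega_closed \<F> \<Longrightarrow> is_semigroup (B_prod \<F>)"
  using B_mul_closed by (auto simp: is_semigroup_def B_prod_def B_mul_assoc simp del: B_mul.simps)

lemma ideal_B_null:
  assumes "omega_closed \<F>"
  shows "is_ideal (B_prod \<F>) (B_null \<F>)"
proof -
  have "B_mul x a \<in> B_null \<F> \<and> B_mul a x \<in> B_null \<F>"
    if "x \<in> carr (B_prod \<F>)" "a \<in> B_null \<F>" for x a
  proof -
    have "a \<in> carr (B_prod \<F>)" using that by (auto simp: B_prod_def B_null_def)
    then have "B_mul x a \<in> carr (B_prod \<F>)" "B_mul a x \<in> carr (B_prod \<F>)"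
      using B_mul_closed[OF assms] that by auto
    moreover have "snd (snd (B_mul x a)) = {}" "snd (snd (B_mul a x)) = {}"
      using that(2) by (cases x; cases a; simp add: B_null_def shift_def)+
    ultimately show ?thesis by (auto simp: B_prod_def B_null_def mem_Times_iff)
  qed
  moreover have "B_null \<F> \<subseteq> carr (B_prod \<F>)" by (auto simp: B_prod_def B_null_def)
  moreover have "mul (B_prod \<F>) = B_mul" by (simp add: B_prod_def)
  ultimately show ?thesis by (simp add: is_ideal_def)
qed

lemma quotient_mul_class:
  assumes "is_congruence S r" "x \<in> carr S" "y \<in> carr S"
  shows "mul (quotient_sgrp S r) (r `` {x}) (r `` {y}) = r `` {mul S x y}"
proof -
  have eq: "equiv (carr S) r" using assms(1) by (simp add: is_congruence_def)
  have *: "r `` {mul S x' y'} = r `` {mul S x y}"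
    if "x' \<in> r `` {x}" "y' \<in> r `` {y}" for x' y'
  proof -
    have "(mul S x y, mul S x' y') \<in> r"
      using assms(1) that by (auto simp: is_congruence_def)
    then show ?thesis using equiv_class_eq[OF eq] by simp
  qed
  have ne: "x \<in> r `` {x}" "y \<in> r `` {y}" using equiv_class_self[OF eq] assms(2,3) by blast+
  have "mul (quotient_sgrp S r) (r `` {x}) (r `` {y})
      = (\<Union>x'\<in>r `` {x}. \<Union>y'\<in>r `` {y}. r `` {mul S x' y'})"
    by (simp add: quotient_sgrp_def)
  also have "\<dots> = (\<Union>x'\<in>r `` {x}. \<Union>y'\<in>r `` {y}. r `` {mul S x y})"
    by (intro SUP_cong refl *)
  also have "\<dots> = r `` {mul S x y}" using ne by blast
  finally show ?thesis .
qed

lemma semigroup_quotient: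
  assumes S: "is_semigroup S" and c: "is_congruence S r"
  shows "is_semigroup (quotient_sgrp S r)"
proof -
  have cq: "carr (quotient_sgrp S r) = (\<lambda>x. r `` {x}) ` carr S"
    by (auto simp: quotient_sgrp_def quotient_def)
  show ?thesis
    using S by (auto simp: is_semigroup_def cq quotient_mul_class[OF c])
qed

lemma congruence_rees:
  assumes "is_semigroup S" "is_ideal S I"
  shows "is_congruence S (I \<times> I \<union> Id_on (carr S))"
proof -
  have "equiv (carr S) (I \<times> I \<union> Id_on (carr S))"
    using assms(2) by (intro equivI) (auto simp: is_ideal_def refl_on_def sym_def trans_def)
  then show ?thesis using assms by (auto simp: is_congruence_def is_semigroup_def is_ideal_def)
qed

lemma semigroup_B_sgrp: "omega_closed \<F> \<Longrightarrow> is_semigroup (B_sgrp \<F>)"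
  unfolding B_sgrp_def rees_quotient_def
  by (intro semigroup_quotient congruence_rees semigroup_B_prod ideal_B_null)

lemma B_sgrp_without_empty:
  assumes "omega_closed \<F>" "{} \<notin> \<F>"
  shows "sgrp_isomorphic (B_prod \<F>) (B_sgrp \<F>)"
proof -
  have I: "B_null \<F> = {}" using assms by (auto simp: B_null_def)
  have "carr (B_sgrp \<F>) = (\<lambda>x. {x}) ` carr (B_prod \<F>)"
    by (auto simp: B_sgrp_def rees_quotient_def quotient_sgrp_def I quotient_def)
  then have "bij_betw (\<lambda>x. {x}) (carr (B_prod \<F>)) (carr (B_sgrp \<F>))"
    by (simp add: bij_betw_def)
  moreover have "{mul (B_prod \<F>) x y} = mul (B_sgrp \<F>) {x} {y}"
    if "x \<in> carr (B_prod \<F>)" "y \<in> carr (B_prod \<F>)" for x y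
  proof -
    have "mul (B_prod \<F>) x y \<in> carr (B_prod \<F>)"
      using semigroup_B_prod[OF assms(1)] that by (simp add: is_semigroup_def)
    then have "Id_on (carr (B_prod \<F>)) `` {mul (B_prod \<F>) x y} = {mul (B_prod \<F>) x y}"
      by auto
    then show ?thesis by (simp add: B_sgrp_def rees_quotient_def quotient_sgrp_def I)
  qed
  ultimately show ?thesis unfolding sgrp_isomorphic_def by blast
qed

lemma right_principal_subset:
  assumes S: "is_semigroup S" and c: "a \<in> carr S" "b \<in> carr S" and ab: "a \<in> right_principal S b"
  shows "right_principal S a \<subseteq> right_principal S b"
proof
  fix x assume "x \<in> right_principal S a"
  then consider "x = a" | s where "s \<in> carr S" "x = mul S a s"
    by (auto simp: right_principal_def)
  then show "x \<in> right_principal S b"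
  proof cases
    case 1
    then show ?thesis using ab by simp
  next
    case (2 s)
    from ab consider "a = b" | t where "t \<in> carr S" "a = mul S b t"
      by (auto simp: right_principal_def)
    then show ?thesis
    proof cases
      case 1
      then show ?thesis using 2 by (auto simp: right_principal_def)
    next
      case (2 t)
      have "x = mul S b (mul S t s)" "mul S t s \<in> carr S"
        using S c 2 \<open>x = mul S a s\<close> \<open>s \<in> carr S\<close> by (simp_all add: is_semigroup_def)
      then show ?thesis by (auto simp: right_principal_def)
    qed
  qed
qed

lemma right_principal_eq_iff:
  assumes "is_semigroup S" "a \<in> carr S" "b \<in> carr S"
  shows "right_principal S a = right_principal S b \<longleftrightarrow>
    a \<in> right_principal S b \<and> b \<in> right_principal S a"
proof -
  have "a \<in> right_principal S a" "b \<in> right_principal S b"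
    by (simp_all add: right_principal_def)
  then show ?thesis
    using right_principal_subset[OF assms] right_principal_subset[OF assms(1,3,2)] by blast
qed

lemma left_principal_subset:
  assumes S: "is_semigroup S" and c: "a \<in> carr S" "b \<in> carr S" and ab: "a \<in> left_principal S b"
  shows "left_principal S a \<subseteq> left_principal S b"
proof
  fix x assume "x \<in> left_principal S a"
  then consider "x = a" | s where "s \<in> carr S" "x = mul S s a"
    by (auto simp: left_principal_def)
  then show "x \<in> left_principal S b"
  proof cases
    case 1
    then show ?thesis using ab by simp
  next
    case (2 s)
    from ab consider "a = b" | t where "t \<in> carr S" "a = mul S t b"
      by (auto simp: left_principal_def)
    then show ?thesis
    proof cases
      case 1
      then show ?thesis using 2 by (auto simp: left_principal_def)
    next
      case (2 t)
      have "x = mul S (mul S s t) b" "mul S s t \<in> carr S"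
        using S c 2 \<open>x = mul S s a\<close> \<open>s \<in> carr S\<close> by (simp_all add: is_semigroup_def)
      then show ?thesis by (auto simp: left_principal_def)
    qed
  qed
qed

lemma left_principal_eq_iff:
  assumes "is_semigroup S" "a \<in> carr S" "b \<in> carr S"
  shows "left_principal S a = left_principal S b \<longleftrightarrow>
    a \<in> left_principal S b \<and> b \<in> left_principal S a"
proof -
  have "a \<in> left_principal S a" "b \<in> left_principal S b"
    by (simp_all add: left_principal_def)
  then show ?thesis
    using left_principal_subset[OF assms] left_principal_subset[OF assms(1,3,2)] by blast
qed

lemma right_principal_mul:
  assumes S: "is_semigroup S" and s: "s \<in> carr S" and b: "b \<in> carr S"
    and ab: "a \<in> right_principal S b"
  shows "mul S s a \<in> right_principal S (mul S s b)"
proof -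
  from ab consider "a = b" | t where "t \<in> carr S" "a = mul S b t"
    by (auto simp: right_principal_def)
  then show ?thesis
  proof cases
    case 1
    then show ?thesis by (simp add: right_principal_def)
  next
    case (2 t)
    then have "mul S s a = mul S (mul S s b) t"
      using S s b by (simp add: is_semigroup_def)
    then show ?thesis using 2 by (auto simp: right_principal_def)
  qed
qed

lemma left_principal_mul:
  assumes S: "is_semigroup S" and s: "s \<in> carr S" and b: "b \<in> carr S"
    and ab: "a \<in> left_principal S b"
  shows "mul S a s \<in> left_principal S (mul S b s)"
proof -
  from ab consider "a = b" | t where "t \<in> carr S" "a = mul S t b"
    by (auto simp: left_principal_def)
  then show ?thesis
  proof cases
    case 1
    then show ?thesis by (simp add: left_principal_def)
  next
    case (2 t)
    then have "mul S a s = mul S t (mul S b s)"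
      using S s b by (simp add: is_semigroup_def)
    then show ?thesis using 2 by (auto simp: left_principal_def)
  qed
qed

lemma green_R_left_mul:
  assumes S: "is_semigroup S" and ab: "(a, b) \<in> green_R S" and s: "s \<in> carr S"
  shows "(mul S s a, mul S s b) \<in> green_R S"
proof -
  have c: "a \<in> carr S" "b \<in> carr S" "mul S s a \<in> carr S" "mul S s b \<in> carr S"
    using S ab s by (auto simp: green_R_def is_semigroup_def)
  have "a \<in> right_principal S b" "b \<in> right_principal S a"
    using ab right_principal_eq_iff[OF S c(1,2)] by (simp_all add: green_R_def)
  then have "mul S s a \<in> right_principal S (mul S s b)" "mul S s b \<in> right_principal S (mul S s a)"
    using right_principal_mul[OF S s] c by blast+
  then show ?thesis using c right_principal_eq_iff[OF S c(3,4)] by (simp add: green_R_def)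
qed

lemma green_L_right_mul:
  assumes S: "is_semigroup S" and ab: "(a, b) \<in> green_L S" and s: "s \<in> carr S"
  shows "(mul S a s, mul S b s) \<in> green_L S"
proof -
  have c: "a \<in> carr S" "b \<in> carr S" "mul S a s \<in> carr S" "mul S b s \<in> carr S"
    using S ab s by (auto simp: green_L_def is_semigroup_def)
  have "a \<in> left_principal S b" "b \<in> left_principal S a"
    using ab left_principal_eq_iff[OF S c(1,2)] by (simp_all add: green_L_def)
  then have "mul S a s \<in> left_principal S (mul S b s)" "mul S b s \<in> left_principal S (mul S a s)"
    using left_principal_mul[OF S s] c by blast+
  then show ?thesis using c left_principal_eq_iff[OF S c(3,4)] by (simp add: green_L_def)
qed

lemma green_L_R_commute:
  assumes S: "is_semigroup S"
  shows "green_L S O green_R S = green_R S O green_L S"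
proof (intro equalityI subrelI)
  fix a b assume "(a, b) \<in> green_L S O green_R S"
  then obtain c where ac: "(a, c) \<in> green_L S" and cb: "(c, b) \<in> green_R S" by auto
  have cs: "a \<in> carr S" "b \<in> carr S" "c \<in> carr S"
    using ac cb by (auto simp: green_L_def green_R_def)
  have "a \<in> left_principal S c" "b \<in> right_principal S c"
    using ac cb by (auto simp: green_L_def green_R_def left_principal_def right_principal_def)
  then consider "a = c" | "b = c"
    | s t where "s \<in> carr S" "a = mul S s c" "t \<in> carr S" "b = mul S c t"
    by (auto simp: left_principal_def right_principal_def)
  then show "(a, b) \<in> green_R S O green_L S"
  proof cases
    case 1
    then show ?thesis using cb cs by (auto simp: green_L_def)
  next
    case 2
    then show ?thesis using ac cs by (auto simp: green_R_def)
  next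
    case 3
    have "(a, mul S s b) \<in> green_R S" using green_R_left_mul[OF S cb] 3 by simp
    moreover have "(mul S s b, b) \<in> green_L S"
      using green_L_right_mul[OF S ac 3(3)] 3 S cs by (simp add: is_semigroup_def)
    ultimately show ?thesis by auto
  qed
next
  fix a b assume "(a, b) \<in> green_R S O green_L S"
  then obtain c where ac: "(a, c) \<in> green_R S" and cb: "(c, b) \<in> green_L S" by auto
  have cs: "a \<in> carr S" "b \<in> carr S" "c \<in> carr S"
    using ac cb by (auto simp: green_L_def green_R_def)
  have "a \<in> right_principal S c" "b \<in> left_principal S c"
    using ac cb by (auto simp: green_L_def green_R_def left_principal_def right_principal_def)
  then consider "a = c" | "b = c"
    | s t where "s \<in> carr S" "a = mul S c s" "t \<in> carr S" "b = mul S t c"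
    by (auto simp: left_principal_def right_principal_def)
  then show "(a, b) \<in> green_L S O green_R S"
  proof cases
    case 1
    then show ?thesis using cb cs by (auto simp: green_R_def)
  next
    case 2
    then show ?thesis using ac cs by (auto simp: green_L_def)
  next
    case 3
    have "(a, mul S b s) \<in> green_L S" using green_L_right_mul[OF S cb] 3 by simp
    moreover have "(mul S b s, b) \<in> green_R S"
      using green_R_left_mul[OF S ac 3(3)] 3 S cs by (simp add: is_semigroup_def)
    ultimately show ?thesis by auto
  qed
qed

lemma equiv_green_D:
  assumes S: "is_semigroup S"
  shows "equiv (carr S) (green_D S)"
proof -
  have L: "equiv (carr S) (green_L S)" and R: "equiv (carr S) (green_R S)"
    by (auto intro!: equivI simp: refl_on_def sym_def trans_def green_L_def green_R_def)
  have sub: "green_D S \<subseteq> carr S \<times> carr S"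
    by (auto simp: green_D_def green_L_def green_R_def)
  have "refl_on (carr S) (green_D S)"
    by (auto simp: refl_on_def green_D_def green_L_def green_R_def)
  moreover have "(green_D S)\<inverse> = green_D S"
    using L R green_L_R_commute[OF S]
    by (simp add: green_D_def converse_relcomp equiv_def sym_conv_converse_eq)
  moreover have DD: "green_D S O green_D S \<subseteq> green_D S"
  proof -
    have "green_D S O green_D S = green_L S O (green_R S O green_L S) O green_R S"
      by (simp add: green_D_def O_assoc)
    also have "\<dots> = (green_L S O green_L S) O (green_R S O green_R S)"
      by (simp add: green_L_R_commute[OF S, symmetric] O_assoc)
    also have "\<dots> \<subseteq> green_D S"
      unfolding green_D_def using L R by (intro relcomp_mono) (auto simp: equiv_def trans_def)
    finally show ?thesis .
  qed
  moreover have "trans (green_D S)" using DD by (intro transI) blast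
  ultimately show ?thesis
    using sub by (intro equivI) (simp_all add: sym_conv_converse_eq)
qed

fun bicyclic_eval :: "bicyclic_gen list \<Rightarrow> nat \<times> nat" where
  "bicyclic_eval [] = (0, 0)"
| "bicyclic_eval (gen_p # w) = mul bicyclic_pairs (0, 1) (bicyclic_eval w)"
| "bicyclic_eval (gen_q # w) = mul bicyclic_pairs (1, 0) (bicyclic_eval w)"

definition bicyclic_word :: "nat \<times> nat \<Rightarrow> bicyclic_gen list" where
  "bicyclic_word x = replicate (fst x) gen_q @ replicate (snd x) gen_p"

lemma bicyclic_pairs_assoc:
  "mul bicyclic_pairs (mul bicyclic_pairs x y) z = mul bicyclic_pairs x (mul bicyclic_pairs y z)"
  by (cases x; cases y; cases z) (auto simp: bicyclic_pairs_def min_def)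

lemma bicyclic_eval_append:
  "bicyclic_eval (u @ v) = mul bicyclic_pairs (bicyclic_eval u) (bicyclic_eval v)"
proof (induction u rule: bicyclic_eval.induct)
  case 1
  then show ?case by (cases "bicyclic_eval v") (simp add: bicyclic_pairs_def)
qed (simp_all add: bicyclic_pairs_assoc)

lemma bicyclic_eq_eval: "bicyclic_eq u v \<Longrightarrow> bicyclic_eval u = bicyclic_eval v"
  by (induction rule: bicyclic_eq.induct) (auto simp: bicyclic_eval_append bicyclic_pairs_def)

lemma bicyclic_eval_word: "bicyclic_eval (bicyclic_word x) = x"
proof -
  have "bicyclic_eval (replicate n gen_p) = (0, n)" for n
    by (induction n) (auto simp: bicyclic_pairs_def)
  moreover have "bicyclic_eval (replicate n gen_q) = (n, 0)" for n
    by (induction n) (auto simp: bicyclic_pairs_def)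
  ultimately show ?thesis
    by (cases x) (simp add: bicyclic_word_def bicyclic_eval_append bicyclic_pairs_def)
qed

lemma bicyclic_eq_word: "bicyclic_eq w (bicyclic_word (bicyclic_eval w))"
proof (induction w rule: bicyclic_eval.induct)
  case 1
  show ?case by (simp add: bicyclic_word_def bicyclic_eq_refl)
next
  case (2 w)
  obtain i j where e: "bicyclic_eval w = (i, j)" by fastforce
  have 1: "bicyclic_eq (gen_p # w) (gen_p # bicyclic_word (i, j))"
    using bicyclic_eq_mult[OF bicyclic_eq_refl[of "[gen_p]"] 2] e by simp
  show ?case
  proof (cases i)
    case 0
    then show ?thesis using 1 e by (simp add: bicyclic_word_def bicyclic_pairs_def)
  next
    case (Suc k)
    have "bicyclic_eq (gen_p # bicyclic_word (i, j)) (bicyclic_word (k, j))"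
      using bicyclic_eq_mult[OF bicyclic_eq_relator bicyclic_eq_refl[of "bicyclic_word (k, j)"]] Suc
      by (simp add: bicyclic_word_def)
    then show ?thesis using bicyclic_eq_trans[OF 1] e Suc by (simp add: bicyclic_pairs_def)
  qed
next
  case (3 w)
  obtain i j where e: "bicyclic_eval w = (i, j)" by fastforce
  have "bicyclic_eq (gen_q # w) (gen_q # bicyclic_word (i, j))"
    using bicyclic_eq_mult[OF bicyclic_eq_refl[of "[gen_q]"] 3] e by simp
  then show ?case using e by (simp add: bicyclic_word_def bicyclic_pairs_def)
qed

lemma bicyclic_eq_iff: "bicyclic_eq u v \<longleftrightarrow> bicyclic_eval u = bicyclic_eval v"
  by (metis bicyclic_eq_eval bicyclic_eq_word bicyclic_eq_sym bicyclic_eq_trans)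

lemma bicyclic_pairs_isomorphic: "sgrp_isomorphic bicyclic_pairs bicyclic_monoid"
proof -
  let ?W = "\<lparr> carr = UNIV, mul = (@) \<rparr> :: bicyclic_gen list sgrp"
  let ?r = "{(u, v). bicyclic_eq u v}"
  let ?h = "\<lambda>x. ?r `` {bicyclic_word x}"
  have cong: "is_congruence ?W ?r"
    unfolding is_congruence_def
    by (auto intro!: equivI simp: refl_on_def sym_def trans_def bicyclic_eq_iff bicyclic_eval_append)
  have cls: "?r `` {u} = ?r `` {v} \<longleftrightarrow> bicyclic_eval u = bicyclic_eval v" for u v
    by (auto simp: bicyclic_eq_iff)
  have "inj ?h" by (rule injI) (simp only: cls bicyclic_eval_word)
  moreover have "range ?h = carr bicyclic_monoid"
  proof -
    have "?r `` {w} = ?h (bicyclic_eval w)" for w by (simp only: cls bicyclic_eval_word)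
    then show ?thesis by (auto simp: bicyclic_monoid_def quotient_sgrp_def quotient_def)
  qed
  moreover have "?h (mul bicyclic_pairs x y) = mul bicyclic_monoid (?h x) (?h y)" for x y
  proof -
    have "mul bicyclic_monoid (?h x) (?h y) = ?r `` {bicyclic_word x @ bicyclic_word y}"
      unfolding bicyclic_monoid_def using quotient_mul_class[OF cong] by simp
    also have "\<dots> = ?h (mul bicyclic_pairs x y)"
      by (simp only: cls bicyclic_eval_word bicyclic_eval_append)
    finally show ?thesis by simp
  qed
  moreover have "carr bicyclic_pairs = UNIV" by (simp add: bicyclic_pairs_def)
  ultimately show ?thesis
    unfolding sgrp_isomorphic_def by (intro exI[of _ ?h]) (simp add: bij_betw_def)
qed

end

theory Submission imports Defs begin

text \<open>
  Everything is reduced to bisimplicity, which is invariant under isomorphism.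

  Condition (i) implies (ii) because Green's relations cannot change the third coordinate. If
  \<open>{} \<notin> \<F>\<close>, a left multiple of \<open>(i, j, F)\<close> either has a larger second coordinate, or has the same
  one and a third coordinate contained in \<open>F\<close>; so \<open>\<L>\<close>-related triples share \<open>j\<close> and \<open>F\<close>. Dually
  \<open>\<R>\<close>-related triples share \<open>i\<close> and \<open>F\<close>, and \<open>\<D>\<close>-related triples therefore share \<open>F\<close>
  (lemma \<open>green_D_B_prod\<close>). If \<open>{} \<in> \<F>\<close>, the semigroup has a zero, whose \<open>\<D>\<close>-class is a singleton,
  so that a bisimple such semigroup consists of the zero alone (lemma \<open>bisimple_zero\<close>).

  Condition (ii) implies (iii) because the \<open>\<omega>\<close>-closed families \<open>{F}\<close> are those with
  \<open>F\<close> closed under adding natural numbers. All intersections in the product of triples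
  then equal \<open>F\<close>, and dropping the third coordinate leaves the bicyclic product
  (lemma \<open>B_prod_singleton\<close>), unless \<open>F = {}\<close>, when only the zero is left.

  Finally, a trivial semigroup and the bicyclic monoid are both bisimple. Hence (iii) implies (i),
  which closes the circle: for (iii) implies (ii) no isomorphism has to be inspected.
\<close>

section \<open>Isomorphisms and bisimplicity\<close>

lemma sgrp_isomorphic_trans:
  assumes "sgrp_isomorphic S T" "sgrp_isomorphic T U"
  shows "sgrp_isomorphic S U"
proof -
  from assms obtain g h where g: "bij_betw g (carr S) (carr T)"
      "\<forall>x\<in>carr S. \<forall>y\<in>carr S. g (mul S x y) = mul T (g x) (g y)"
    and h: "bij_betw h (carr T) (carr U)"
      "\<forall>x\<in>carr T. \<forall>y\<in>carr T. h (mul T x y) = mul U (h x) (h y)"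
    unfolding sgrp_isomorphic_def by blast
  have "g x \<in> carr T" if "x \<in> carr S" for x using g(1) that by (auto simp: bij_betw_def)
  then show ?thesis
    unfolding sgrp_isomorphic_def using bij_betw_trans[OF g(1) h(1)] g(2) h(2)
    by (intro exI[of _ "h \<circ> g"]) simp
qed

lemma sgrp_isomorphic_sym:
  assumes S: "is_semigroup S" and "sgrp_isomorphic S T"
  shows "sgrp_isomorphic T S"
proof -
  from assms(2) obtain h where h: "bij_betw h (carr S) (carr T)"
      and hm: "\<forall>x\<in>carr S. \<forall>y\<in>carr S. h (mul S x y) = mul T (h x) (h y)"
    unfolding sgrp_isomorphic_def by blast
  let ?g = "inv_into (carr S) h"
  have "?g (mul T x y) = mul S (?g x) (?g y)" if "x \<in> carr T" "y \<in> carr T" for x y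
  proof -
    have g: "?g x \<in> carr S" "?g y \<in> carr S" "h (?g x) = x" "h (?g y) = y"
      using h that by (auto simp: bij_betw_def inv_into_into f_inv_into_f)
    then have "mul S (?g x) (?g y) \<in> carr S" using S by (simp add: is_semigroup_def)
    moreover have "mul T x y = h (mul S (?g x) (?g y))" using hm g by simp
    ultimately show ?thesis using h by (simp add: bij_betw_def)
  qed
  then show ?thesis
    unfolding sgrp_isomorphic_def using bij_betw_inv_into[OF h] by blast
qed

lemma is_semigroup_iso:
  assumes S: "is_semigroup S" and "sgrp_isomorphic S T"
  shows "is_semigroup T"
proof -
  from assms(2) obtain h where h: "carr T = h ` carr S"
      and hm: "\<forall>x\<in>carr S. \<forall>y\<in>carr S. h (mul S x y) = mul T (h x) (h y)"
    unfolding sgrp_isomorphic_def bij_betw_def by blast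
  have c: "mul S x y \<in> carr S" if "x \<in> carr S" "y \<in> carr S" for x y
    using S that by (simp add: is_semigroup_def)
  have "mul T (mul T (h x) (h y)) (h z) = mul T (h x) (mul T (h y) (h z))"
    if "x \<in> carr S" "y \<in> carr S" "z \<in> carr S" for x y z
  proof -
    have "mul T (mul T (h x) (h y)) (h z) = h (mul S (mul S x y) z)" using hm c that by simp
    also have "\<dots> = h (mul S x (mul S y z))" using S that by (simp add: is_semigroup_def)
    also have "\<dots> = mul T (h x) (mul T (h y) (h z))" using hm c that by simp
    finally show ?thesis .
  qed
  moreover have "mul T (h x) (h y) \<in> h ` carr S" if "x \<in> carr S" "y \<in> carr S" for x y
    using hm c[OF that] that by (metis imageI)
  ultimately show ?thesis by (auto simp: is_semigroup_def h)
qed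

lemma bisimple_iff:
  assumes S: "is_semigroup S"
  shows "bisimple S \<longleftrightarrow> carr S \<noteq> {} \<and> (\<forall>x\<in>carr S. \<forall>y\<in>carr S. (x, y) \<in> green_D S)"
proof -
  have eq: "equiv (carr S) (green_D S)" by (rule equiv_green_D[OF S])
  have "(\<exists>C. carr S // green_D S = {C}) \<longleftrightarrow>
    carr S \<noteq> {} \<and> (\<forall>x\<in>carr S. \<forall>y\<in>carr S. green_D S `` {x} = green_D S `` {y})"
  proof (intro iffI conjI ballI)
    assume "\<exists>C. carr S // green_D S = {C}"
    then obtain C where C: "carr S // green_D S = {C}" by blast
    then show "carr S \<noteq> {}" by (auto simp: quotient_def)
    show "green_D S `` {x} = green_D S `` {y}" if "x \<in> carr S" "y \<in> carr S" for x y
      using C that quotientI[of _ "carr S" "green_D S"] by (metis singletonD)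
  next
    assume "carr S \<noteq> {} \<and> (\<forall>x\<in>carr S. \<forall>y\<in>carr S. green_D S `` {x} = green_D S `` {y})"
    then obtain a where "a \<in> carr S" "\<forall>x\<in>carr S. green_D S `` {x} = green_D S `` {a}" by blast
    then have "carr S // green_D S = {green_D S `` {a}}" unfolding quotient_def by blast
    then show "\<exists>C. carr S // green_D S = {C}" by blast
  qed
  also have "\<dots> \<longleftrightarrow> carr S \<noteq> {} \<and> (\<forall>x\<in>carr S. \<forall>y\<in>carr S. (x, y) \<in> green_D S)"
    using eq_equiv_class_iff[OF eq] by blast
  finally show ?thesis using S by (simp add: bisimple_def)
qed

text \<open>An isomorphism carries principal one-sided ideals to principal one-sided ideals, hence
  preserves all of Green's relations.\<close>

lemma bisimple_iso:
  assumes bi: "bisimple S" and iso: "sgrp_isomorphic S T"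
  shows "bisimple T"
proof -
  have S: "is_semigroup S" using bi by (simp add: bisimple_def)
  have T: "is_semigroup T" by (rule is_semigroup_iso[OF S iso])
  from iso obtain h where h: "carr T = h ` carr S"
      and hm': "\<forall>x\<in>carr S. \<forall>y\<in>carr S. h (mul S x y) = mul T (h x) (h y)"
    unfolding sgrp_isomorphic_def bij_betw_def by blast
  have hm: "h (mul S x y) = mul T (h x) (h y)" if "x \<in> carr S" "y \<in> carr S" for x y
    using hm' that by simp
  have rp: "right_principal T (h a) = h ` right_principal S a" if "a \<in> carr S" for a
  proof -
    have "{mul T (h a) t |t. t \<in> carr T} = (\<lambda>s. h (mul S a s)) ` carr S"
      using hm[OF that] unfolding h by auto
    then show ?thesis by (auto simp: right_principal_def)
  qed
  have lp: "left_principal T (h a) = h ` left_principal S a" if "a \<in> carr S" for a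
  proof -
    have "{mul T t (h a) |t. t \<in> carr T} = (\<lambda>s. h (mul S s a)) ` carr S"
      using hm[OF _ that] unfolding h by auto
    then show ?thesis by (auto simp: left_principal_def)
  qed
  have "(h x, h y) \<in> green_D T" if "(x, y) \<in> green_D S" for x y
  proof -
    from that obtain z where "(x, z) \<in> green_L S" "(z, y) \<in> green_R S"
      by (auto simp: green_D_def)
    then have "(h x, h z) \<in> green_L T" "(h z, h y) \<in> green_R T"
      by (auto simp: green_L_def green_R_def rp lp h)
    then show ?thesis by (auto simp: green_D_def)
  qed
  then show ?thesis using bi unfolding bisimple_iff[OF S] bisimple_iff[OF T] h by blast
qed

lemma bisimple_trivial:
  assumes "is_semigroup S" "trivial_sgrp S"
  shows "bisimple S"
proof -
  obtain e where e: "carr S = {e}" using assms(2) by (auto simp: trivial_sgrp_def)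
  then have "(e, e) \<in> green_D S" by (auto simp: green_D_def green_L_def green_R_def)
  then show ?thesis using e by (simp add: bisimple_iff[OF assms(1)])
qed

text \<open>The one-sided ideals generated by a zero \<open>z\<close> are \<open>{z}\<close>, so \<open>{z}\<close> is a \<open>\<D>\<close>-class.\<close>

lemma bisimple_zero:
  assumes bi: "bisimple S" and z: "z \<in> carr S"
    and zero: "\<And>x. x \<in> carr S \<Longrightarrow> mul S x z = z" "\<And>x. x \<in> carr S \<Longrightarrow> mul S z x = z"
  shows "carr S = {z}"
proof -
  have S: "is_semigroup S" using bi by (simp add: bisimple_def)
  have P: "left_principal S z = {z}" "right_principal S z = {z}"
    using zero by (auto simp: left_principal_def right_principal_def)
  have "x = z" if "x \<in> carr S" for x
  proof -
    have "(z, x) \<in> green_D S" using bi that z bisimple_iff[OF S] by blast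
    then obtain c where c: "left_principal S z = left_principal S c"
        "right_principal S c = right_principal S x"
      by (auto simp: green_D_def green_L_def green_R_def)
    have "c = z" using c(1) P(1) by (auto simp: left_principal_def)
    then show ?thesis using c(2) P(2) by (auto simp: right_principal_def)
  qed
  then show ?thesis using z by blast
qed

section \<open>The bicyclic monoid is bisimple\<close>

lemma is_semigroup_bicyclic_pairs: "is_semigroup bicyclic_pairs"
  by (simp add: is_semigroup_def bicyclic_pairs_assoc) (simp add: bicyclic_pairs_def)

lemma bisimple_bicyclic_pairs: "bisimple bicyclic_pairs"
proof -
  let ?B = bicyclic_pairs
  note S = is_semigroup_bicyclic_pairs
  have c: "x \<in> carr ?B" for x by (simp add: bicyclic_pairs_def)
  \<comment> \<open>The second coordinate determines the \<open>\<L>\<close>-class, since \<open>(i, i') (i', j) = (i, j)\<close>;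
    dually for the first coordinate and \<open>\<R>\<close>.\<close>
  have l: "(i, j) \<in> left_principal ?B (i', j)" for i i' j
  proof -
    have "(i, j) = mul ?B (i, i') (i', j)" by (simp add: bicyclic_pairs_def)
    then show ?thesis using c by (auto simp only: left_principal_def)
  qed
  have r: "(i, j) \<in> right_principal ?B (i, j')" for i j j'
  proof -
    have "(i, j) = mul ?B (i, j') (j', j)" by (simp add: bicyclic_pairs_def)
    then show ?thesis using c by (auto simp only: right_principal_def)
  qed
  have L: "((i, j), (i', j)) \<in> green_L ?B" for i i' j
    using left_principal_eq_iff[OF S c c] l c by (simp add: green_L_def)
  have R: "((i, j), (i, j')) \<in> green_R ?B" for i j j'
    using right_principal_eq_iff[OF S c c] r c by (simp add: green_R_def)
  have "(x, y) \<in> green_D ?B" for x y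
    using L R unfolding green_D_def by (cases x; cases y) blast
  then show ?thesis using c by (auto simp: bisimple_iff[OF S])
qed

lemma bisimple_bicyclic_monoid: "bisimple bicyclic_monoid"
  by (rule bisimple_iso[OF bisimple_bicyclic_pairs bicyclic_pairs_isomorphic])

section \<open>Bisimplicity forces a one-element family\<close>

lemma left_principal_B_prod:
  assumes "(i, j, F) \<in> left_principal (B_prod \<F>) (i', j', F')"
  shows "j' \<le> j" "j = j' \<Longrightarrow> F \<subseteq> F'"
proof -
  consider "(i, j, F) = (i', j', F')" | k l G where "(i, j, F) = B_mul (k, l, G) (i', j', F')"
    using assms by (auto simp: left_principal_def B_prod_def simp del: B_mul.simps)
  then have "j' \<le> j \<and> (j = j' \<longrightarrow> F \<subseteq> F')"
    by cases (auto simp: B_mul_nat simp del: B_mul.simps split: if_splits)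
  then show "j' \<le> j" "j = j' \<Longrightarrow> F \<subseteq> F'" by auto
qed

lemma right_principal_B_prod:
  assumes "(i, j, F) \<in> right_principal (B_prod \<F>) (i', j', F')"
  shows "i' \<le> i" "i = i' \<Longrightarrow> F \<subseteq> F'"
proof -
  consider "(i, j, F) = (i', j', F')" | k l G where "(i, j, F) = B_mul (i', j', F') (k, l, G)"
    using assms by (auto simp: right_principal_def B_prod_def simp del: B_mul.simps)
  then have "i' \<le> i \<and> (i = i' \<longrightarrow> F \<subseteq> F')"
  proof cases
    case 2
    \<comment> \<open>The factor adds to \<open>i'\<close> exactly when \<open>j' < k\<close>, so \<open>i = i'\<close> rules out a shift of \<open>F'\<close>.\<close>
    consider "j' < k" | "j' = k" | "k < j'" by linarith
    then show ?thesis
      by cases (use 2 in \<open>auto simp: B_mul_nat simp del: B_mul.simps\<close>)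
  qed simp
  then show "i' \<le> i" "i = i' \<Longrightarrow> F \<subseteq> F'" by auto
qed

lemma green_D_B_prod:
  assumes "((i, j, F), (i', j', F')) \<in> green_D (B_prod \<F>)"
  shows "F = F'"
proof -
  obtain k l G where
      L: "left_principal (B_prod \<F>) (i, j, F) = left_principal (B_prod \<F>) (k, l, G)"
    and R: "right_principal (B_prod \<F>) (k, l, G) = right_principal (B_prod \<F>) (i', j', F')"
    using assms by (auto simp: green_D_def green_L_def green_R_def)
  have self: "x \<in> left_principal (B_prod \<F>) x" "x \<in> right_principal (B_prod \<F>) x" for x
    by (simp_all add: left_principal_def right_principal_def)
  have "(i, j, F) \<in> left_principal (B_prod \<F>) (k, l, G)"
    "(k, l, G) \<in> left_principal (B_prod \<F>) (i, j, F)"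
    using L self by blast+
  then have "F = G" using left_principal_B_prod by (metis order_antisym)
  have "(i', j', F') \<in> right_principal (B_prod \<F>) (k, l, G)"
    "(k, l, G) \<in> right_principal (B_prod \<F>) (i', j', F')"
    using R self by blast+
  then have "F' = G" using right_principal_B_prod by (metis order_antisym)
  then show ?thesis using \<open>F = G\<close> by simp
qed

lemma bisimple_B_prod_imp:
  assumes "bisimple (B_prod \<F>)" "F \<in> \<F>" "G \<in> \<F>"
  shows "F = G"
proof -
  have "is_semigroup (B_prod \<F>)" using assms(1) by (simp add: bisimple_def)
  then have "((0, 0, F), (0, 0, G)) \<in> green_D (B_prod \<F>)"
    using assms by (simp add: bisimple_iff B_prod_def)
  then show ?thesis by (rule green_D_B_prod)
qed

text \<open>When \<open>{} \<in> \<F>\<close>, the class of the triples with empty third coordinate is a zero.\<close>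

lemma bisimple_B_sgrp_empty_imp:
  assumes cl: "omega_closed \<F>" and e: "{} \<in> \<F>" and bi: "bisimple (B_sgrp \<F>)"
  shows "\<F> = {{}}"
proof -
  let ?S = "B_prod \<F>" and ?N = "B_null \<F>"
  let ?r = "?N \<times> ?N \<union> Id_on (carr ?S)"
  have id: "is_ideal ?S ?N" by (rule ideal_B_null[OF cl])
  have cong: "is_congruence ?S ?r" by (rule congruence_rees[OF semigroup_B_prod[OF cl] id])
  have cq: "carr (B_sgrp \<F>) = (\<lambda>x. ?r `` {x}) ` carr ?S"
    by (auto simp: B_sgrp_def rees_quotient_def quotient_sgrp_def quotient_def)
  have N: "?r `` {x} = ?N" if "x \<in> ?N" for x
    using that by (auto simp: B_null_def)
  let ?o = "(0, 0, {}) :: nat \<times> nat \<times> nat set"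
  have o: "?o \<in> ?N" "?o \<in> carr ?S" using e by (auto simp: B_null_def B_prod_def)
  have q: "mul (B_sgrp \<F>) (?r `` {x}) (?r `` {y}) = ?r `` {mul ?S x y}"
    if "x \<in> carr ?S" "y \<in> carr ?S" for x y
    using quotient_mul_class[OF cong that] by (simp add: B_sgrp_def rees_quotient_def)
  have zero: "mul (B_sgrp \<F>) X ?N = ?N \<and> mul (B_sgrp \<F>) ?N X = ?N" if X: "X \<in> carr (B_sgrp \<F>)" for X
  proof -
    obtain x where x: "x \<in> carr ?S" "X = ?r `` {x}" using X unfolding cq by blast
    have "mul ?S x ?o \<in> ?N" "mul ?S ?o x \<in> ?N" using id o x by (auto simp: is_ideal_def)
    then show ?thesis using q[OF x(1) o(2)] q[OF o(2) x(1)] N N[OF o(1)] x(2) by metis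
  qed
  have "?N \<in> carr (B_sgrp \<F>)"
    unfolding cq by (rule image_eqI[where x = ?o]) (simp only: N[OF o(1)], rule o(2))
  then have one: "carr (B_sgrp \<F>) = {?N}"
    by (rule bisimple_zero[OF bi]) (simp_all only: zero)
  have "F = {}" if "F \<in> \<F>" for F
  proof -
    have F: "(0, 0, F) \<in> carr ?S" using that by (simp add: B_prod_def)
    then have "?r `` {(0, 0, F)} \<in> carr (B_sgrp \<F>)" unfolding cq by (rule imageI)
    then have "?r `` {(0, 0, F)} = ?N" by (simp only: one singleton_iff)
    then have "(0, 0, F) \<in> ?N" using F by blast
    then show ?thesis by (simp add: B_null_def)
  qed
  then show ?thesis using e by blast
qed

lemma bisimple_B_sgrp_imp:
  assumes ne: "\<F> \<noteq> {}" and cl: "omega_closed \<F>" and bi: "bisimple (B_sgrp \<F>)"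
  shows "\<exists>F. \<F> = {F}"
proof (cases "{} \<in> \<F>")
  case True
  then show ?thesis using bisimple_B_sgrp_empty_imp[OF cl _ bi] by blast
next
  case False
  have "sgrp_isomorphic (B_sgrp \<F>) (B_prod \<F>)"
    by (rule sgrp_isomorphic_sym[OF semigroup_B_prod[OF cl] B_sgrp_without_empty[OF cl False]])
  then have "bisimple (B_prod \<F>)" by (rule bisimple_iso[OF bi])
  then show ?thesis using bisimple_B_prod_imp ne by blast
qed

section \<open>One-element families\<close>

lemma B_prod_singleton:
  assumes cl: "omega_closed {F}"
  shows "sgrp_isomorphic (B_prod {F}) bicyclic_pairs"
proof -
  have "F \<inter> shift (- int n) F = F" for n using cl by (simp add: omega_closed_def)
  then have up: "k + n \<in> F" if "k \<in> F" for k n using that mem_shift_neg by blast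
  have F: "{k \<in> F. k + n \<in> F} = F" for n using up by blast
  let ?h = "\<lambda>(i, j, _ :: nat set). (i :: nat, j :: nat)"
  have "bij_betw ?h (carr (B_prod {F})) (carr bicyclic_pairs)"
    by (auto simp: bij_betw_def inj_on_def B_prod_def bicyclic_pairs_def image_iff)
  moreover have "?h (mul (B_prod {F}) x y) = mul bicyclic_pairs (?h x) (?h y)"
    if "x \<in> carr (B_prod {F})" "y \<in> carr (B_prod {F})" for x y
    using that
    by (auto simp: B_prod_def bicyclic_pairs_def B_mul_nat F min_def simp del: B_mul.simps)
  ultimately show ?thesis unfolding sgrp_isomorphic_def by blast
qed

lemma trivial_B_sgrp_empty: "trivial_sgrp (B_sgrp {{}})"
proof -
  have "carr (B_sgrp {{}}) = {B_null {{}}}"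
    by (auto simp: B_sgrp_def rees_quotient_def quotient_sgrp_def quotient_def B_prod_def B_null_def)
  then show ?thesis by (auto simp: trivial_sgrp_def)
qed

lemma B_sgrp_singleton:
  assumes cl: "omega_closed {F}" and ne: "F \<noteq> {}"
  shows "sgrp_isomorphic (B_sgrp {F}) bicyclic_monoid"
proof -
  have "sgrp_isomorphic (B_sgrp {F}) (B_prod {F})"
    using sgrp_isomorphic_sym[OF semigroup_B_prod[OF cl] B_sgrp_without_empty[OF cl]] ne by simp
  then show ?thesis
    using B_prod_singleton[OF cl] bicyclic_pairs_isomorphic by (blast intro: sgrp_isomorphic_trans)
qed

section \<open>The characterization\<close>

theorem mainTheorem11:
  fixes \<F> :: "nat set set"
  assumes "\<F> \<noteq> {}" and "omega_closed \<F>"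
  shows "(bisimple (B_sgrp \<F>) \<longleftrightarrow> (\<exists>F. \<F> = {F})) \<and>
         ((\<exists>F. \<F> = {F}) \<longleftrightarrow>
            trivial_sgrp (B_sgrp \<F>) \<or> sgrp_isomorphic (B_sgrp \<F>) bicyclic_monoid)"
proof -
  let ?B = "B_sgrp \<F>"
  have S: "is_semigroup ?B" by (rule semigroup_B_sgrp[OF assms(2)])
  have "\<exists>F. \<F> = {F}" if "bisimple ?B"
    by (rule bisimple_B_sgrp_imp[OF assms that])
  moreover have "trivial_sgrp ?B \<or> sgrp_isomorphic ?B bicyclic_monoid" if "\<exists>F. \<F> = {F}"
    using that assms(2) trivial_B_sgrp_empty B_sgrp_singleton by blast
  moreover have "bisimple ?B" if "trivial_sgrp ?B \<or> sgrp_isomorphic ?B bicyclic_monoid"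
    using that bisimple_trivial[OF S] bisimple_iso[OF bisimple_bicyclic_monoid]
      sgrp_isomorphic_sym[OF S] by blast
  ultimately show ?thesis by blast
qed

end
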